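(* Let $\Gamma$ be a numerical semigroup minimally generated by $n_1<\dots<n_r$, let $k$ be a positive integer with $\gcd(k,n_1)=1$, and let $\Gamma_k=\langle n_1,kn_2,\dots,kn_r\rangle$ be the $k$-lifting of $\Gamma$. If $\mathrm{res}(\Gamma)\le g(\Gamma)-n(\Gamma)$, then $\mathrm{res}(\Gamma_k)\le g(\Gamma_k)-n(\Gamma_k)$.
   Context: $\mathbb{K}$ is a field. A numerical semigroup $H$ is a submonoid of $\mathbb{N}$ (non-negative integers) with finite complement; numerical semigroups are assumed to have more than one minimal generator. $\mathrm{F}(H)$ is the largest integer in $\mathbb{N}\setminus H$, $g(H)=|\mathbb{N}\setminus H|$, and $n(H)=|\{s\in H: s<\mathrm{F}(H)\}|$. $\mathbb{K}[H]\subset\mathbb{K}[t]$ is the semigroup ring spanned by the $t^h$, $h\in H$, $\omega_{\mathbb{K}[H]}$ is its canonical module, and $\mathrm{tr}(\omega_{\mathbb{K}[H]})=\sum_{\phi\in\mathrm{Hom}(\omega_{\mathbb{K}[H]},\mathbb{K}[H])}\phi(\omega_{\mathbb{K}[H]})$ is its trace ideal. The residue is $\mathrm{res}(H)=\dim_{\mathbb{K}}\mathbb{K}[H]/\mathrm{tr}(\omega_{\mathbb{K}[H]})$. *)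

theory Defs
  imports "HOL-Computational_Algebra.Polynomial"
begin

section \<open>Numerical semigroups\<close>

definition numerical_semigroup :: "nat set \<Rightarrow> bool" where
  "numerical_semigroup H \<longleftrightarrow>
     0 \<in> H \<and> (\<forall>a\<in>H. \<forall>b\<in>H. a + b \<in> H) \<and> finite (- H)"

inductive_set submonoid_generated :: "nat set \<Rightarrow> nat set" for A :: "nat set" where
  zero: "0 \<in> submonoid_generated A"
| gen: "a \<in> A \<Longrightarrow> a \<in> submonoid_generated A"
| add: "a \<in> submonoid_generated A \<Longrightarrow> b \<in> submonoid_generated A
          \<Longrightarrow> a + b \<in> submonoid_generated A"

definition minimally_generates :: "nat set \<Rightarrow> nat set \<Rightarrow> bool" where
  "minimally_generates A H \<longleftrightarrow>
     submonoid_generated A = H \<and> (\<forall>B. B \<subset> A \<longrightarrow> submonoid_generated B \<noteq> H)"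

text \<open>Meaningful for a numerical semigroup different from the set of all natural numbers,
  i.e. one with more than one minimal generator.\<close>

definition frobenius_number :: "nat set \<Rightarrow> nat" where
  "frobenius_number H = Max (- H)"

definition genus :: "nat set \<Rightarrow> nat" where
  "genus H = card (- H)"

definition sporadic_number :: "nat set \<Rightarrow> nat" where
  "sporadic_number H = card {s \<in> H. s < frobenius_number H}"


section \<open>Trace of a module over a subring\<close>

text \<open>\<open>R\<close> is the carrier of a subring and \<open>M\<close>, \<open>N\<close> are \<open>R\<close>-submodules of the ambient ring.
  A homomorphism is a total function of which only the values on \<open>M\<close> matter.\<close>

definition module_homs ::
    "'a::comm_ring_1 set \<Rightarrow> 'a set \<Rightarrow> 'a set \<Rightarrow> ('a \<Rightarrow> 'a) set" where
  "module_homs R M N =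
     {\<phi>. (\<forall>x\<in>M. \<phi> x \<in> N) \<and>
         (\<forall>x\<in>M. \<forall>y\<in>M. \<phi> (x + y) = \<phi> x + \<phi> y) \<and>
         (\<forall>r\<in>R. \<forall>x\<in>M. \<phi> (r * x) = r * \<phi> x)}"

text \<open>The sum of the submodules \<open>\<phi> ` M\<close>, as the set of all finite sums of their elements.\<close>

definition trace_ideal :: "'a::comm_ring_1 set \<Rightarrow> 'a set \<Rightarrow> 'a set" where
  "trace_ideal R M =
     {(\<Sum>i<m. \<phi> i (x i)) | (m::nat) \<phi> x.
        \<forall>i<m. \<phi> i \<in> module_homs R M R \<and> x i \<in> M}"


section \<open>Dimension of a quotient space\<close>

text \<open>For subspaces \<open>W \<subseteq> V\<close>, the set \<open>B\<close> is a system of representatives of a basis of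
  \<open>V / W\<close>.\<close>

definition quotient_basis ::
    "'a::field poly set \<Rightarrow> 'a poly set \<Rightarrow> 'a poly set \<Rightarrow> bool" where
  "quotient_basis V W B \<longleftrightarrow>
     B \<subseteq> V \<and>
     (\<forall>S c. finite S \<and> S \<subseteq> B \<and> (\<Sum>b\<in>S. smult (c b) b) \<in> W \<longrightarrow> (\<forall>b\<in>S. c b = 0)) \<and>
     (\<forall>v\<in>V. \<exists>S c. finite S \<and> S \<subseteq> B \<and> v - (\<Sum>b\<in>S. smult (c b) b) \<in> W)"

text \<open>As for \<open>dim\<close> in the library, an infinite-dimensional quotient gets the value \<open>0\<close>.
  This does not occur in \<open>residue\<close> below, since the trace of the canonical module
  contains \<open>t^N\<close> for all large \<open>N\<close>.\<close>

definition quotient_dim :: "'a::field poly set \<Rightarrow> 'a poly set \<Rightarrow> nat" where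
  "quotient_dim V W = card (SOME B. quotient_basis V W B)"


section \<open>Semigroup ring, canonical module and residue\<close>

definition semigroup_ring :: "nat set \<Rightarrow> 'a::field poly set" where
  "semigroup_ring H = module.span smult ((\<lambda>h. monom 1 h) ` H)"

text \<open>The canonical module of the one-dimensional graded domain \<open>R = K[H]\<close> is the graded
  \<open>K\<close>-dual of its local cohomology module \<open>K[t, t^(-1)] / R\<close>, i.e. the fractional ideal
  spanned by the \<open>t^(-z)\<close> with \<open>z \<in> \<int> - H\<close>. It is determined up to isomorphism (and the
  trace depends only on the isomorphism class), so it is multiplied here by \<open>t^F\<close>, with \<open>F\<close>
  the Frobenius number, to obtain a submodule of \<open>K[t]\<close>. All exponents \<open>F - z\<close> are
  non-negative because \<open>F\<close> is the largest integer outside \<open>H\<close>.\<close>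

definition canonical_module :: "nat set \<Rightarrow> 'a::field poly set" where
  "canonical_module H =
     module.span smult
       {monom 1 (nat (int (frobenius_number H) - z)) | z :: int. z \<notin> int ` H}"

definition residue :: "'a::field itself \<Rightarrow> nat set \<Rightarrow> nat" where
  "residue _ H =
     quotient_dim (semigroup_ring H :: 'a poly set)
       (trace_ideal (semigroup_ring H) (canonical_module H))"


section \<open>Liftings\<close>

text \<open>The \<open>k\<close>-lifting of the semigroup generated by \<open>n 1 < \<dots> < n r\<close>.\<close>

definition lifting :: "nat \<Rightarrow> nat \<Rightarrow> (nat \<Rightarrow> nat) \<Rightarrow> nat set" where
  "lifting k r n = submonoid_generated (insert (n 1) ((\<lambda>i. k * n i) ` {2..r}))"

end

theory Submission
  imports Defs
begin

text \<open>
  Lifting multiplies both sides of the inequality by \<open>k\<close>, so the lifted inequality is the original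
  one scaled. The reason is the following. Put \<open>a = n\<^sub>1\<close>. Since \<open>a \<in> \<Gamma>\<close> and
  \<open>gcd(k, a) = 1\<close>, every integer is \<open>k y + a j\<close> for exactly one pair of an integer \<open>y\<close> and
  \<open>0 \<le> j < k\<close>, and \<open>k y + a j\<close> belongs to \<open>\<Gamma>\<^sub>k\<close> iff \<open>y\<close> belongs to \<open>\<Gamma>\<close>
  (\<open>digits_bij\<close>, \<open>digits_mem_iff\<close>). So \<open>\<Gamma>\<^sub>k\<close>, as a subset of \<open>\<int>\<close>, is \<open>k\<close> disjoint copies
  of \<open>\<Gamma>\<close>, and its Frobenius number is \<open>k F(\<Gamma>) + a (k - 1)\<close>. Any invariant that counts
  integers satisfying a condition that depends on \<open>y\<close> alone is therefore multiplied by \<open>k\<close>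
  (\<open>card_digitwise\<close>). Both invariants are of this form:

  \<^item> \<open>g(H) - n(H)\<close> is the number of integers \<open>z\<close> with \<open>z \<notin> H\<close> and \<open>F(H) - z \<notin> H\<close>
    (\<open>genus_minus_sporadic_number\<close>), and the reflection at \<open>F(\<Gamma>\<^sub>k)\<close> takes \<open>(y, j)\<close> to
    \<open>(F(\<Gamma>) - y, k - 1 - j)\<close>.

  \<^item> \<open>res(H)\<close> is the number of \<open>h \<in> H\<close> that are not exponents of the trace
    (\<open>residue_eq_card\<close>), where \<open>h\<close> is such an exponent iff there is an integer \<open>g \<notin> H\<close> with
    \<open>h + g - g' \<in> H\<close> for all integers \<open>g' \<notin> H\<close> (\<open>trace_canonical_module\<close>). For \<open>\<Gamma>\<^sub>k\<close>
    and \<open>h = k y + a j\<close> this is the same condition on \<open>y\<close> for \<open>\<Gamma>\<close>, because the gap \<open>g\<close> may be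
    taken with last digit \<open>k - 1\<close>, or the gaps \<open>g'\<close> may be tested with the same last digit as
    \<open>g\<close> (\<open>digits_trace_exps_iff\<close>).

  The formula for \<open>res(H)\<close> rests on two facts. All homomorphisms from the canonical module to the
  semigroup ring are multiplications by polynomials, since the canonical module has rank one and
  is normalised to contain \<open>1\<close>; so the trace is spanned by monomials. And the dimension of
  a quotient of spaces spanned by monomials is the number of monomials lost.
\<close>

section \<open>Polynomials with prescribed exponents\<close>

definition polys_on :: "nat set \<Rightarrow> 'a::field poly set" where
  "polys_on S = {p. \<forall>i. coeff p i \<noteq> 0 \<longrightarrow> i \<in> S}"

lemma vector_space_smult: "vector_space (smult :: 'a::field \<Rightarrow> 'a poly \<Rightarrow> 'a poly)"
  by unfold_locales (auto simp: smult_add_right smult_add_left)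

interpretation poly_vs: vector_space "smult :: 'a::field \<Rightarrow> 'a poly \<Rightarrow> 'a poly"
  by (rule vector_space_smult)

lemma zero_in_polys_on [simp]: "0 \<in> polys_on S"
  by (simp add: polys_on_def)

lemma polys_on_add: "p \<in> polys_on S \<Longrightarrow> q \<in> polys_on S \<Longrightarrow> p + q \<in> polys_on S"
  unfolding polys_on_def by simp (metis add.right_neutral)

lemma polys_on_sum: "(\<And>i. i \<in> I \<Longrightarrow> f i \<in> polys_on S) \<Longrightarrow> (\<Sum>i\<in>I. f i) \<in> polys_on S"
  by (induction I rule: infinite_finite_induct) (auto intro: polys_on_add)

lemma monom_in_polys_on: "monom c h \<in> polys_on S \<longleftrightarrow> c = 0 \<or> h \<in> S"
  by (auto simp: polys_on_def)

lemma span_monoms: "module.span smult ((\<lambda>h. monom (1::'a::field) h) ` S) = polys_on S"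
proof
  have "poly_vs.subspace (polys_on S :: 'a poly set)"
    by (rule poly_vs.subspaceI) (auto intro: polys_on_add, auto simp: polys_on_def)
  then show "poly_vs.span ((\<lambda>h. monom 1 h) ` S) \<subseteq> (polys_on S :: 'a poly set)"
    by (rule poly_vs.span_minimal[rotated]) (auto simp: monom_in_polys_on)
next
  show "(polys_on S :: 'a poly set) \<subseteq> poly_vs.span ((\<lambda>h. monom 1 h) ` S)"
  proof
    fix p :: "'a poly" assume p: "p \<in> polys_on S"
    have "monom (coeff p i) i \<in> poly_vs.span ((\<lambda>h. monom 1 h) ` S)" for i
    proof (cases "coeff p i = 0")
      case False
      then have "smult (coeff p i) (monom 1 i) \<in> poly_vs.span ((\<lambda>h. monom 1 h) ` S)"
        using p by (intro poly_vs.span_scale poly_vs.span_base) (auto simp: polys_on_def)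
      then show ?thesis by (simp add: smult_monom)
    qed (simp add: poly_vs.span_zero)
    then have "(\<Sum>i\<le>degree p. monom (coeff p i) i) \<in> poly_vs.span ((\<lambda>h. monom 1 h) ` S)"
      by (intro poly_vs.span_sum)
    then show "p \<in> poly_vs.span ((\<lambda>h. monom 1 h) ` S)"
      by (simp add: poly_as_sum_of_monoms)
  qed
qed

lemma polys_on_mult:
  assumes "p \<in> polys_on A" "q \<in> polys_on B" "\<And>a b. a \<in> A \<Longrightarrow> b \<in> B \<Longrightarrow> a + b \<in> C"
  shows "p * q \<in> polys_on C"
  unfolding polys_on_def
proof (intro CollectI allI impI)
  fix i assume "coeff (p * q) i \<noteq> 0"
  then have "(\<Sum>j\<le>i. coeff p j * coeff q (i - j)) \<noteq> 0"
    by (simp add: coeff_mult)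
  then obtain j where "j \<le> i" "coeff p j * coeff q (i - j) \<noteq> 0"
    by (meson sum.not_neutral_contains_not_neutral atMost_iff)
  then have "j \<in> A" "i - j \<in> B" "i = j + (i - j)"
    using assms(1,2) by (auto simp: polys_on_def)
  then show "i \<in> C"
    using assms(3) by metis
qed

text \<open>For \<open>D = S - T\<close> this is a projection of the polynomials with exponents in \<open>S\<close> whose kernel
  consists of those with exponents in \<open>T\<close>, so it replaces the passage to
  the quotient space and keeps everything inside the vector space of polynomials.\<close>

definition restrict_exps :: "nat set \<Rightarrow> 'a::field poly \<Rightarrow> 'a poly" where
  "restrict_exps D p = (\<Sum>i\<le>degree p. if i \<in> D then monom (coeff p i) i else 0)"

lemma coeff_restrict_exps: "coeff (restrict_exps D p) i = (if i \<in> D then coeff p i else 0)"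
proof -
  have "coeff (restrict_exps D p) i =
      (\<Sum>j\<le>degree p. if j = i then (if i \<in> D then coeff p i else 0) else 0)"
    unfolding restrict_exps_def coeff_sum by (intro sum.cong) auto
  also have "\<dots> = (if i \<in> D then coeff p i else 0)"
    by (auto simp: coeff_eq_0)
  finally show ?thesis .
qed

lemma restrict_exps_combination:
  "restrict_exps D (\<Sum>b\<in>S. smult (c b) b) = (\<Sum>b\<in>S. smult (c b) (restrict_exps D b))"
  by (rule poly_eqI) (simp add: coeff_restrict_exps coeff_sum)

lemma restrict_exps_diff: "restrict_exps D (p - q) = restrict_exps D p - restrict_exps D q"
  by (rule poly_eqI) (simp add: coeff_restrict_exps)

lemma restrict_exps_eq_0_iff:
  assumes "p \<in> polys_on S"
  shows "restrict_exps (S - T) p = 0 \<longleftrightarrow> p \<in> polys_on T"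
  using assms by (auto simp: poly_eq_iff coeff_restrict_exps polys_on_def)

lemma polys_on_combination:
  "B \<subseteq> polys_on S \<Longrightarrow> (\<Sum>b\<in>B. smult (c b) b) \<in> polys_on S"
  by (rule polys_on_sum) (auto simp: polys_on_def)

text \<open>The projection is injective on representatives of a basis of the quotient, and maps them to a
  basis of the polynomials with exponents in \<open>S - T\<close>. Hence all such systems of representatives have
  the same size, and the choice made in the definition of the dimension is irrelevant.\<close>

lemma card_quotient_basis:
  fixes B :: "'a::field poly set"
  assumes B: "quotient_basis (polys_on S) (polys_on T) B"
  shows "card B = poly_vs.dim (polys_on (S - T) :: 'a poly set)"
proof -
  let ?D = "S - T"
  let ?\<pi> = "restrict_exps ?D :: 'a poly \<Rightarrow> 'a poly"
  have BS: "B \<subseteq> polys_on S"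
    and ind: "\<And>X c. finite X \<Longrightarrow> X \<subseteq> B \<Longrightarrow> (\<Sum>b\<in>X. smult (c b) b) \<in> polys_on T
                \<Longrightarrow> \<forall>b\<in>X. c b = 0"
    and gen: "\<And>v. v \<in> polys_on S \<Longrightarrow>
                \<exists>X c. finite X \<and> X \<subseteq> B \<and> v - (\<Sum>b\<in>X. smult (c b) b) \<in> polys_on T"
    using B unfolding quotient_basis_def by blast+
  have inj: "inj_on ?\<pi> B"
  proof (rule inj_onI, rule ccontr)
    fix b b' assume b: "b \<in> B" "b' \<in> B" "?\<pi> b = ?\<pi> b'" "b \<noteq> b'"
    \<comment> \<open>The difference would be a nontrivial combination that vanishes in the quotient.\<close>
    let ?c = "\<lambda>x. if x = b then 1 else - 1 :: 'a"
    have comb: "(\<Sum>x\<in>{b, b'}. smult (?c x) x) = b - b'"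
      using b by simp
    have "b - b' \<in> polys_on S"
      using polys_on_combination[of "{b, b'}" S ?c] BS b(1,2) unfolding comb by blast
    moreover have "?\<pi> (b - b') = 0"
      using b by (simp add: restrict_exps_diff)
    ultimately have "b - b' \<in> polys_on T"
      using restrict_exps_eq_0_iff by blast
    then have "\<forall>x\<in>{b, b'}. ?c x = 0"
      using ind[of "{b, b'}" ?c] comb b by simp
    then show False by simp
  qed
  have indep: "poly_vs.independent (?\<pi> ` B)"
    unfolding poly_vs.dependent_explicit
  proof (rule notI, elim exE conjE)
    fix Y u assume Y: "finite Y" "Y \<subseteq> ?\<pi> ` B" "\<exists>v\<in>Y. u v \<noteq> 0" "(\<Sum>v\<in>Y. smult (u v) v) = 0"
    obtain X where X: "X \<subseteq> B" "Y = ?\<pi> ` X" "finite X"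
      using finite_subset_image[OF Y(1,2)] by blast
    have injX: "inj_on ?\<pi> X"
      using inj X(1) inj_on_subset by blast
    have "?\<pi> (\<Sum>b\<in>X. smult (u (?\<pi> b)) b) = 0"
      using Y(4) unfolding X(2) sum.reindex[OF injX] by (simp add: restrict_exps_combination)
    moreover have "(\<Sum>b\<in>X. smult (u (?\<pi> b)) b) \<in> polys_on S"
      using X(1) BS by (intro polys_on_combination) auto
    ultimately have "(\<Sum>b\<in>X. smult (u (?\<pi> b)) b) \<in> polys_on T"
      using restrict_exps_eq_0_iff by blast
    then show False
      using ind[OF X(3,1), of "\<lambda>b. u (?\<pi> b)"] Y(3) X(2) by auto
  qed
  have "polys_on ?D \<subseteq> poly_vs.span (?\<pi> ` B)"
  proof
    fix p :: "'a poly" assume p: "p \<in> polys_on ?D"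
    then have pS: "p \<in> polys_on S" and fixed: "?\<pi> p = p"
      by (auto simp: polys_on_def poly_eq_iff coeff_restrict_exps)
    obtain X c where X: "finite X" "X \<subseteq> B" "p - (\<Sum>b\<in>X. smult (c b) b) \<in> polys_on T"
      using gen[OF pS] by blast
    have "?\<pi> (p - (\<Sum>b\<in>X. smult (c b) b)) = 0"
      using X(3) by (auto simp: poly_eq_iff coeff_restrict_exps polys_on_def)
    then have "p = (\<Sum>b\<in>X. smult (c b) (?\<pi> b))"
      by (simp add: restrict_exps_diff restrict_exps_combination fixed)
    also have "\<dots> \<in> poly_vs.span (?\<pi> ` B)"
      using X(2) by (intro poly_vs.span_sum poly_vs.span_scale poly_vs.span_base) auto
    finally show "p \<in> poly_vs.span (?\<pi> ` B)" .
  qed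
  moreover have "?\<pi> ` B \<subseteq> polys_on ?D"
    by (auto simp: polys_on_def coeff_restrict_exps split: if_splits)
  ultimately have "poly_vs.dim (polys_on ?D :: 'a poly set) = card (?\<pi> ` B)"
    using indep by (metis poly_vs.basis_card_eq_dim)
  then show ?thesis
    by (simp add: card_image[OF inj])
qed

lemma quotient_basis_monoms:
  assumes "T \<subseteq> S"
  shows "quotient_basis (polys_on S) (polys_on T) ((\<lambda>h. monom (1::'a::field) h) ` (S - T))"
  unfolding quotient_basis_def
proof (intro conjI allI impI ballI)
  show "(\<lambda>h. monom (1::'a) h) ` (S - T) \<subseteq> polys_on S"
    by (auto simp: monom_in_polys_on)
next
  fix X :: "'a poly set" and c b
  assume X: "finite X \<and> X \<subseteq> (\<lambda>h. monom 1 h) ` (S - T) \<and> (\<Sum>b\<in>X. smult (c b) b) \<in> polys_on T"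
    and b: "b \<in> X"
  then obtain h where h: "h \<in> S - T" "b = monom 1 h" by blast
  have "coeff (\<Sum>b\<in>X. smult (c b) b) h = (\<Sum>x\<in>X. if x = b then c b else 0)"
    unfolding coeff_sum
  proof (rule sum.cong)
    fix x assume "x \<in> X"
    then obtain i where "x = monom 1 i" using X by blast
    then show "coeff (smult (c x) x) h = (if x = b then c b else 0)"
      using h by (auto simp: monom_eq_iff')
  qed simp
  also have "\<dots> = c b" using X b by simp
  finally have "coeff (\<Sum>b\<in>X. smult (c b) b) h = c b" .
  moreover have "coeff (\<Sum>b\<in>X. smult (c b) b) h = 0"
    using X h(1) unfolding polys_on_def by blast
  ultimately show "c b = 0" by simp
next
  fix v :: "'a poly" assume v: "v \<in> polys_on S"
  let ?X = "{i \<in> S - T. i \<le> degree v}"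
  have inj: "inj_on (\<lambda>h. monom (1::'a) h) ?X"
    by (auto simp: inj_on_def monom_eq_iff')
  have "(\<Sum>b\<in>(\<lambda>h. monom 1 h) ` ?X. smult (coeff v (degree b)) b)
      = (\<Sum>i\<in>?X. monom (coeff v i) i)"
    unfolding sum.reindex[OF inj] by (simp add: degree_monom_eq smult_monom)
  also have "\<dots> = restrict_exps (S - T) v"
    unfolding restrict_exps_def
    by (rule sum.mono_neutral_cong_left) auto
  finally have "v - (\<Sum>b\<in>(\<lambda>h. monom 1 h) ` ?X. smult (coeff v (degree b)) b) \<in> polys_on T"
    using v by (auto simp: polys_on_def coeff_restrict_exps split: if_splits)
  then show "\<exists>X c. finite X \<and> X \<subseteq> (\<lambda>h. monom 1 h) ` (S - T) \<and>
      v - (\<Sum>b\<in>X. smult (c b) b) \<in> polys_on T"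
    by (intro exI[of _ "(\<lambda>h. monom 1 h) ` ?X"] exI[of _ "\<lambda>b. coeff v (degree b)"]) auto
qed

lemma quotient_dim_polys_on:
  assumes "T \<subseteq> S"
  shows "quotient_dim (polys_on S) (polys_on T :: 'a::field poly set) = card (S - T)"
proof -
  let ?M = "(\<lambda>h. monom (1::'a) h) ` (S - T)"
  have M: "quotient_basis (polys_on S) (polys_on T) ?M"
    using assms by (rule quotient_basis_monoms)
  have "quotient_dim (polys_on S) (polys_on T :: 'a poly set) = card ?M"
    unfolding quotient_dim_def card_quotient_basis[OF M]
    by (rule card_quotient_basis, rule someI, rule M)
  also have "\<dots> = card (S - T)"
    by (rule card_image) (auto simp: inj_on_def monom_eq_iff')
  finally show ?thesis .
qed

section \<open>The trace of the canonical module\<close>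

definition canonical_exps :: "nat set \<Rightarrow> nat set" where
  "canonical_exps H = {nat (int (frobenius_number H) - z) | z. z \<notin> int ` H}"

text \<open>The sumset \<open>K + (H - K)\<close>, where \<open>K\<close> is the canonical ideal \<open>{F - g | g \<notin> H}\<close> and
  \<open>H - K\<close> is the set of all \<open>z\<close> with \<open>z + K \<subseteq> H\<close>: writing \<open>h = (F - g) + z\<close>, the
  condition on \<open>z = h + g - F\<close> is that \<open>h + g - g' \<in> H\<close> for all gaps \<open>g'\<close>. In this form the
  Frobenius number has cancelled. Negative integers count as gaps.\<close>

definition trace_exps :: "nat set \<Rightarrow> int set" where
  "trace_exps H = {h. \<exists>g. g \<notin> int ` H \<and> (\<forall>g'. g' \<notin> int ` H \<longrightarrow> h + g - g' \<in> int ` H)}"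

lemma trace_exps_subset: "trace_exps H \<subseteq> int ` H"
proof
  fix h assume "h \<in> trace_exps H"
  then obtain g where "h + g - g \<in> int ` H" unfolding trace_exps_def by blast
  then show "h \<in> int ` H" by simp
qed

lemma semigroup_ring_eq: "semigroup_ring H = polys_on H"
  by (simp add: semigroup_ring_def span_monoms)

lemma canonical_module_eq: "canonical_module H = polys_on (canonical_exps H)"
  unfolding canonical_module_def span_monoms[symmetric] canonical_exps_def
  by (rule arg_cong[of _ _ "module.span smult"]) blast

lemma frobenius_number_gap:
  assumes "finite (- H)" "H \<noteq> UNIV"
  shows "frobenius_number H \<notin> H"
  using Max_in[of "- H"] assms unfolding frobenius_number_def by auto

lemma int_gap_le_frobenius_number:
  assumes "finite (- H)" "z \<notin> int ` H"
  shows "z \<le> int (frobenius_number H)"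
proof (cases "z < 0")
  case False
  then obtain m where "z = int m" by (metis int_nat_eq linorder_not_less)
  then have "m \<in> - H" using assms(2) by auto
  then have "m \<le> frobenius_number H"
    unfolding frobenius_number_def using assms(1) by (rule Max_ge[rotated])
  then show ?thesis using \<open>z = int m\<close> by simp
qed simp

lemma image_int_D: "int m \<in> int ` H \<Longrightarrow> m \<in> H"
  by (simp add: inj_image_mem_iff)

text \<open>The element \<open>y\<close> of \<open>H - K\<close> can be taken in the natural numbers: \<open>0\<close> lies in \<open>K\<close> because
  \<open>F\<close> is a gap, so \<open>H - K \<subseteq> H\<close>.\<close>

lemma mem_sumset_iff_trace_exps:
  assumes fin: "finite (- H)" and ne: "H \<noteq> UNIV"
  defines "K \<equiv> canonical_exps H"
  shows "(\<exists>x\<in>K. \<exists>y. h = x + y \<and> (\<forall>x'\<in>K. y + x' \<in> H)) \<longleftrightarrow> int h \<in> trace_exps H"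
proof -
  let ?F = "frobenius_number H"
  note le = int_gap_le_frobenius_number[OF fin]
  have K: "x \<in> K \<longleftrightarrow> int ?F - int x \<notin> int ` H" for x
  proof
    assume "x \<in> K"
    then obtain z where "z \<notin> int ` H" "x = nat (int ?F - z)"
      unfolding K_def canonical_exps_def by blast
    then show "int ?F - int x \<notin> int ` H" using le[of z] by simp
  next
    assume "int ?F - int x \<notin> int ` H"
    then show "x \<in> K"
      unfolding K_def canonical_exps_def by (intro CollectI exI[of _ "int ?F - int x"]) simp
  qed
  show ?thesis
  proof
    assume "\<exists>x\<in>K. \<exists>y. h = x + y \<and> (\<forall>x'\<in>K. y + x' \<in> H)"
    then obtain x y where xy: "x \<in> K" "h = x + y" "\<And>x'. x' \<in> K \<Longrightarrow> y + x' \<in> H" by blast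
    have "int h + (int ?F - int x) - g' \<in> int ` H" if g': "g' \<notin> int ` H" for g'
    proof -
      have "nat (int ?F - g') \<in> K" using g' unfolding K_def canonical_exps_def by blast
      then have "int (y + nat (int ?F - g')) \<in> int ` H" using xy(3) by blast
      moreover have "int (y + nat (int ?F - g')) = int h + (int ?F - int x) - g'"
        using le[OF g'] xy(2) by simp
      ultimately show ?thesis by simp
    qed
    then show "int h \<in> trace_exps H"
      unfolding trace_exps_def using K[of x] xy(1) by blast
  next
    assume "int h \<in> trace_exps H"
    then obtain g where g: "g \<notin> int ` H" "\<And>g'. g' \<notin> int ` H \<Longrightarrow> int h + g - g' \<in> int ` H"
      unfolding trace_exps_def by blast
    let ?x = "nat (int ?F - g)"
    have x: "int ?x = int ?F - g" using le[OF g(1)] by simp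
    have "int ?F \<notin> int ` H" using frobenius_number_gap[OF fin ne] by auto
    from g(2)[OF this] obtain y where y: "y \<in> H" "int h + g - int ?F = int y" by blast
    have "?x \<in> K" using g(1) unfolding K_def canonical_exps_def by blast
    moreover have "h = ?x + y" using x y by linarith
    moreover have "y + x' \<in> H" if "x' \<in> K" for x'
    proof -
      have "int h + g - (int ?F - int x') \<in> int ` H"
        using that K g(2) by blast
      moreover have "int h + g - (int ?F - int x') = int (y + x')" using y(2) by simp
      ultimately have "int (y + x') \<in> int ` H" by simp
      then show ?thesis by (rule image_int_D)
    qed
    ultimately show "\<exists>x\<in>K. \<exists>y. h = x + y \<and> (\<forall>x'\<in>K. y + x' \<in> H)" by blast
  qed
qed

text \<open>Linearity cannot be applied to \<open>m * 1\<close> directly, since \<open>m\<close> need not lie in the ring. But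
  \<open>t^(F + 1)\<close> multiplies every polynomial into the ring, so \<open>t^(F + 1) * m * 1\<close> can be evaluated
  in two ways and \<open>t^(F + 1)\<close> cancelled.\<close>

lemma canonical_hom_is_multiplication:
  assumes fin: "finite (- H)" and ne: "H \<noteq> UNIV"
    and \<phi>: "\<phi> \<in> module_homs (polys_on H) (polys_on (canonical_exps H)) (polys_on H)"
    and m: "m \<in> polys_on (canonical_exps H)"
  shows "\<phi> m = \<phi> 1 * (m :: 'a::field poly)"
proof -
  let ?F = "frobenius_number H"
  let ?t = "monom (1::'a) (Suc ?F)"
  have big: "i \<in> H" if "i > ?F" for i
    using int_gap_le_frobenius_number[OF fin, of "int i"] that by force
  have "int ?F \<notin> int ` H" using frobenius_number_gap[OF fin ne] by auto
  then have "0 \<in> canonical_exps H" unfolding canonical_exps_def by force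
  then have one: "1 \<in> (polys_on (canonical_exps H) :: 'a poly set)"
    by (auto simp: polys_on_def)
  have t: "?t \<in> polys_on H" using big by (simp add: monom_in_polys_on)
  have tm: "?t * m \<in> polys_on H"
    by (rule polys_on_mult[of _ "{Suc ?F}" _ UNIV])
       (auto simp: monom_in_polys_on polys_on_def intro: big)
  have lin: "\<phi> (r * x) = r * \<phi> x" if "r \<in> polys_on H" "x \<in> polys_on (canonical_exps H)" for r x
    using \<phi> that unfolding module_homs_def by blast
  have "?t * \<phi> m = ?t * m * \<phi> 1"
    using lin[OF t m] lin[OF tm one] by simp
  then have "?t * \<phi> m = ?t * (\<phi> 1 * m)"
    by (simp add: mult_ac)
  then show ?thesis
    by (simp add: monom_eq_0_iff)
qed

text \<open>If multiplication by \<open>f\<close> maps the canonical module into the ring, then so does every monomial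
  of \<open>f\<close>, because both sides are spanned by monomials. So the exponents of \<open>f\<close> lie in \<open>H - K\<close>,
  and the values have exponents in \<open>K + (H - K)\<close>. Conversely, multiplication by \<open>t^y\<close> with
  \<open>y \<in> H - K\<close> takes \<open>t^x\<close> with \<open>x \<in> K\<close> to \<open>t^(x + y)\<close>.\<close>

lemma trace_canonical_module:
  assumes fin: "finite (- H)" and ne: "H \<noteq> UNIV"
  shows "trace_ideal (semigroup_ring H) (canonical_module H)
    = (polys_on {h. int h \<in> trace_exps H} :: 'a::field poly set)"
  unfolding semigroup_ring_eq canonical_module_eq
proof (intro equalityI subsetI)
  let ?K = "canonical_exps H"
  fix p :: "'a poly"
  assume "p \<in> trace_ideal (polys_on H) (polys_on ?K)"
  then obtain m :: nat and \<phi> x where p: "p = (\<Sum>i<m. \<phi> i (x i))"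
    and hom: "\<And>i. i < m \<Longrightarrow> \<phi> i \<in> module_homs (polys_on H) (polys_on ?K) (polys_on H)"
    and x: "\<And>i. i < m \<Longrightarrow> x i \<in> polys_on ?K"
    unfolding trace_ideal_def by blast
  have "\<phi> i (x i) \<in> polys_on {h. int h \<in> trace_exps H}" if i: "i < m" for i
  proof -
    note mult = canonical_hom_is_multiplication[OF fin ne hom[OF i]]
    have f: "\<phi> i 1 \<in> polys_on {y. \<forall>x'\<in>?K. y + x' \<in> H}"
      unfolding polys_on_def
    proof (intro CollectI allI impI ballI)
      fix y x' assume y: "coeff (\<phi> i 1) y \<noteq> 0" and x': "x' \<in> ?K"
      have mon: "monom 1 x' \<in> (polys_on ?K :: 'a poly set)"
        using x' by (simp add: monom_in_polys_on)
      then have "\<phi> i (monom 1 x') \<in> polys_on H"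
        using hom[OF i] unfolding module_homs_def by blast
      then have "monom 1 x' * \<phi> i 1 \<in> polys_on H"
        using mult[OF mon] by (simp add: mult.commute)
      moreover have "coeff (monom 1 x' * \<phi> i 1) (y + x') \<noteq> 0"
        using y by (simp add: coeff_monom_mult)
      ultimately show "y + x' \<in> H"
        unfolding polys_on_def by blast
    qed
    have "\<phi> i 1 * x i \<in> polys_on {h. int h \<in> trace_exps H}"
      using f x[OF i]
    proof (rule polys_on_mult)
      fix y x' assume *: "y \<in> {y. \<forall>x'\<in>?K. y + x' \<in> H}" "x' \<in> ?K"
      have "\<exists>x\<in>?K. \<exists>z. y + x' = x + z \<and> (\<forall>x'\<in>?K. z + x' \<in> H)"
        using * by (intro bexI[of _ x'] exI[of _ y]) auto
      then show "y + x' \<in> {h. int h \<in> trace_exps H}"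
        using mem_sumset_iff_trace_exps[OF fin ne] by blast
    qed
    then show ?thesis using mult[OF x[OF i]] by simp
  qed
  then show "p \<in> polys_on {h. int h \<in> trace_exps H}"
    unfolding p by (intro polys_on_sum) auto
next
  let ?K = "canonical_exps H"
  fix p :: "'a poly"
  assume p: "p \<in> polys_on {h. int h \<in> trace_exps H}"
  have "\<exists>\<phi> x. \<phi> \<in> module_homs (polys_on H) (polys_on ?K) (polys_on H) \<and> x \<in> polys_on ?K
      \<and> \<phi> x = monom (coeff p i) i" for i
  proof (cases "coeff p i = 0")
    case True
    have "(\<lambda>_. 0) \<in> module_homs (polys_on H) (polys_on ?K) (polys_on H :: 'a poly set)"
      by (auto simp: module_homs_def polys_on_def)
    moreover have "0 \<in> (polys_on ?K :: 'a poly set)" by (simp add: polys_on_def)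
    ultimately show ?thesis using True by (intro exI[of _ "\<lambda>_. 0"] exI[of _ 0]) auto
  next
    case False
    then have "int i \<in> trace_exps H" using p by (auto simp: polys_on_def)
    then obtain x y where xy: "x \<in> ?K" "i = x + y" "\<And>x'. x' \<in> ?K \<Longrightarrow> y + x' \<in> H"
      using mem_sumset_iff_trace_exps[OF fin ne, of i] by blast
    have "monom 1 y * q \<in> polys_on H" if "q \<in> polys_on ?K" for q :: "'a poly"
      using _ that by (rule polys_on_mult[of _ "{y}"]) (use xy(3) in \<open>auto simp: monom_in_polys_on\<close>)
    then have "(\<lambda>q. monom 1 y * q) \<in> module_homs (polys_on H) (polys_on ?K) (polys_on H :: 'a poly set)"
      unfolding module_homs_def by (simp add: algebra_simps)
    moreover have "monom (coeff p i) x \<in> polys_on ?K" using xy(1) by (simp add: monom_in_polys_on)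
    moreover have "monom 1 y * monom (coeff p i) x = monom (coeff p i) i"
      using xy(2) by (simp add: mult_monom add.commute)
    ultimately show ?thesis by blast
  qed
  then obtain \<phi> x where "\<And>i. \<phi> i \<in> module_homs (polys_on H) (polys_on ?K) (polys_on H)"
    "\<And>i. x i \<in> polys_on ?K" and val: "\<And>i. \<phi> i (x i) = monom (coeff p i) i"
    by metis
  moreover have "p = (\<Sum>i<Suc (degree p). \<phi> i (x i))"
    unfolding val lessThan_Suc_atMost by (simp add: poly_as_sum_of_monoms)
  ultimately show "p \<in> trace_ideal (polys_on H) (polys_on ?K)"
    unfolding trace_ideal_def by blast
qed

lemma residue_eq_card:
  assumes "finite (- H)" "H \<noteq> UNIV"
  shows "residue TYPE('a::field) H = card (int ` H - trace_exps H)"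
proof -
  let ?T = "{h. int h \<in> trace_exps H}"
  have "?T \<subseteq> H" using trace_exps_subset[of H] by auto
  then have "residue TYPE('a) H = card (H - ?T)"
    unfolding residue_def trace_canonical_module[OF assms]
    by (simp add: semigroup_ring_eq quotient_dim_polys_on)
  also have "\<dots> = card (int ` (H - ?T))"
    by (simp add: card_image)
  also have "int ` (H - ?T) = int ` H - trace_exps H" by auto
  finally show ?thesis .
qed

section \<open>Genus minus sporadic number\<close>

definition double_gaps :: "nat set \<Rightarrow> int set" where
  "double_gaps H = {z. z \<notin> int ` H \<and> int (frobenius_number H) - z \<notin> int ` H}"

text \<open>The reflection \<open>z \<mapsto> F - z\<close> takes elements of \<open>H\<close> below \<open>F\<close> to gaps, for otherwise \<open>F\<close>
  would be a sum of two elements of \<open>H\<close>. The gaps outside the image of this injection are those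
  whose reflection is a gap too. Such gaps are automatically non-negative, since no integer above
  \<open>F\<close> is a gap.\<close>

lemma genus_minus_sporadic_number:
  assumes H: "numerical_semigroup H" and ne: "H \<noteq> UNIV"
  shows "int (genus H) - int (sporadic_number H) = int (card (double_gaps H))"
proof -
  let ?F = "frobenius_number H"
  have fin: "finite (- H)" using H by (simp add: numerical_semigroup_def)
  note le = int_gap_le_frobenius_number[OF fin]
  have F: "?F \<notin> H" using frobenius_number_gap[OF fin ne] .
  let ?G = "int ` (- H)"
  let ?N = "(\<lambda>s. int ?F - int s) ` {s \<in> H. s < ?F}"
  have G: "z \<in> ?G \<longleftrightarrow> 0 \<le> z \<and> z \<notin> int ` H" for z
  proof
    assume z: "0 \<le> z \<and> z \<notin> int ` H"
    then have "z = int (nat z)" by simp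
    moreover have "nat z \<in> - H" using z calculation by blast
    ultimately show "z \<in> ?G" by blast
  qed auto
  have "?G = ?N \<union> double_gaps H"
  proof (intro equalityI subsetI)
    fix z assume z: "z \<in> ?G"
    show "z \<in> ?N \<union> double_gaps H"
    proof (cases "int ?F - z \<in> int ` H")
      case True
      then obtain s where s: "s \<in> H" "int ?F - z = int s" by blast
      then have "s \<le> ?F" using z by (auto simp: G)
      moreover have "s \<noteq> ?F" using s(1) F by auto
      ultimately have "s < ?F" by simp
      then show ?thesis using s by (auto intro!: rev_image_eqI[of s])
    qed (use z in \<open>auto simp: double_gaps_def G\<close>)
  next
    fix z assume "z \<in> ?N \<union> double_gaps H"
    then show "z \<in> ?G"
    proof
      assume "z \<in> ?N"
      then obtain s where s: "s \<in> H" "s < ?F" "z = int ?F - int s" by blast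
      have "z \<notin> int ` H"
      proof
        assume "z \<in> int ` H"
        then obtain u where u: "u \<in> H" "z = int u" by blast
        then have "?F = s + u" using s by linarith
        moreover have "s + u \<in> H" using s(1) u(1) H by (simp add: numerical_semigroup_def)
        ultimately show False using F by simp
      qed
      then show ?thesis using s by (simp add: G)
    next
      assume "z \<in> double_gaps H"
      then show ?thesis using le[of "int ?F - z"] by (auto simp: G double_gaps_def)
    qed
  qed
  moreover have "?N \<inter> double_gaps H = {}"
    by (auto simp: double_gaps_def)
  moreover have "finite ?G" using fin by simp
  ultimately have "card ?G = card ?N + card (double_gaps H)"
    by (metis card_Un_disjoint finite_Un)
  moreover have "card ?G = genus H"
    by (simp add: card_image genus_def)
  moreover have "card ?N = sporadic_number H"
    unfolding sporadic_number_def by (rule card_image) (auto simp: inj_on_def)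
  ultimately show ?thesis by simp
qed

section \<open>Liftings\<close>

text \<open>The multiples \<open>k s\<close> of elements \<open>s\<close> of the original semigroup lie in the lifted one although the
  generator \<open>a\<close> is not scaled, since \<open>k a\<close> is a multiple of the generator \<open>a\<close>.\<close>

lemma mem_lifted_semigroup:
  "z \<in> submonoid_generated (insert a ((\<lambda>b. k * b) ` B)) \<longleftrightarrow>
     (\<exists>s\<in>submonoid_generated (insert a B). \<exists>j. z = k * s + a * j)"
  (is "z \<in> ?L \<longleftrightarrow> _")
proof
  assume "z \<in> ?L"
  then show "\<exists>s\<in>submonoid_generated (insert a B). \<exists>j. z = k * s + a * j"
  proof (induction rule: submonoid_generated.induct)
    case zero
    show ?case by (rule bexI[of _ 0]) (auto intro: submonoid_generated.zero)
  next
    case (gen c)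
    show ?case
    proof (cases "c = a")
      case True
      then show ?thesis
        by (intro bexI[of _ 0] exI[of _ 1]) (auto intro: submonoid_generated.zero)
    next
      case False
      then obtain b where "b \<in> B" "c = k * b" using gen by blast
      then show ?thesis
        by (intro bexI[of _ b] exI[of _ 0]) (auto intro: submonoid_generated.gen)
    qed
  next
    case (add c d)
    then obtain s j s' j' where *: "s \<in> submonoid_generated (insert a B)" "c = k * s + a * j"
      "s' \<in> submonoid_generated (insert a B)" "d = k * s' + a * j'" by blast
    then have "c + d = k * (s + s') + a * (j + j')" by (simp add: algebra_simps)
    moreover have "s + s' \<in> submonoid_generated (insert a B)"
      using * by (intro submonoid_generated.add)
    ultimately show ?case by blast
  qed
next
  have mult: "a * j \<in> ?L" for j
  proof (induction j)
    case (Suc j)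
    then show ?case by (auto intro: submonoid_generated.add[OF submonoid_generated.gen[of a]])
  qed (simp add: submonoid_generated.zero)
  have scaled: "k * s \<in> ?L" if "s \<in> submonoid_generated (insert a B)" for s
    using that
  proof (induction rule: submonoid_generated.induct)
    case (gen c)
    then have "c = a \<or> k * c \<in> (\<lambda>b. k * b) ` B" by blast
    then show ?case
      using mult[of k] by (auto simp: mult.commute intro: submonoid_generated.gen)
  next
    case zero
    show ?case by (simp add: submonoid_generated.zero)
  next
    case (add c d)
    show ?case unfolding distrib_left using add.IH by (rule submonoid_generated.add)
  qed
  assume "\<exists>s\<in>submonoid_generated (insert a B). \<exists>j. z = k * s + a * j"
  then obtain s j where "s \<in> submonoid_generated (insert a B)" "z = k * s + a * j" by blast
  then show "z \<in> ?L" using submonoid_generated.add[OF scaled mult] by simp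
qed

text \<open>The lifting is described here by its elements instead of its generators, as the counting
  arguments are about elements only.\<close>

locale lifted =
  fixes \<Gamma> L :: "nat set" and k a :: nat
  assumes sgp: "numerical_semigroup \<Gamma>" and proper: "\<Gamma> \<noteq> UNIV"
    and k_pos: "0 < k" and cop: "coprime k a" and a_mem: "a \<in> \<Gamma>"
    and mem_L: "\<And>z. z \<in> L \<longleftrightarrow> (\<exists>s\<in>\<Gamma>. \<exists>j. z = k * s + a * j)"
begin

text \<open>Integers in the mixed radix with weights \<open>k\<close> and \<open>a\<close>; the intended last digits are
  \<open>0, \<dots>, k - 1\<close>.\<close>

definition digits :: "int \<times> int \<Rightarrow> int" where
  "digits = (\<lambda>(y, j). int k * y + int a * j)"

lemma digits_bij: "bij_betw digits (UNIV \<times> {0..<int k}) UNIV"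
  unfolding bij_betw_def
proof
  have "y = y' \<and> j = j'"
    if j: "0 \<le> j" "j < int k" "0 \<le> j'" "j' < int k"
      and eq: "int k * y + int a * j = int k * y' + int a * j'" for y j y' j'
  proof -
    have "int k dvd int a * (j - j')"
      using eq by (intro dvdI[of _ _ "y' - y"]) (simp add: algebra_simps)
    then have "int k dvd j - j'"
      using cop by (simp add: coprime_dvd_mult_right_iff)
    moreover have "\<bar>j - j'\<bar> < int k" using j by linarith
    ultimately have "j = j'" using zdvd_imp_le[of "int k" "\<bar>j - j'\<bar>"] by force
    then show ?thesis using eq k_pos by simp
  qed
  then show "inj_on digits (UNIV \<times> {0..<int k})"
    unfolding digits_def
    by (intro inj_onI) (simp only: mem_Times_iff split_beta atLeastLessThan_iff prod_eq_iff, blast)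
next
  have "z \<in> digits ` (UNIV \<times> {0..<int k})" for z
  proof -
    have "coprime (int k) (int a)" using cop by simp
    then obtain u v where uv: "u * int k + v * int a = 1"
      using bezout_int[of "int k" "int a"] by auto
    let ?q = "v * z div int k" and ?j = "v * z mod int k"
    have "v * z = int k * ?q + ?j" by simp
    have "z = (u * int k + v * int a) * z" using uv by simp
    also have "\<dots> = int k * (u * z) + int a * (v * z)" by (simp add: algebra_simps)
    also have "\<dots> = int k * (u * z) + int a * (int k * ?q + ?j)" by simp
    also have "\<dots> = digits (u * z + int a * ?q, ?j)"
      unfolding digits_def by (simp only: prod.case algebra_simps)
    finally show ?thesis using k_pos by (intro image_eqI[of _ _ "(u * z + int a * ?q, ?j)"]) auto
  qed
  then show "digits ` (UNIV \<times> {0..<int k}) = UNIV" by blast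
qed

lemma add_multiple_mem:
  assumes "z \<in> int ` L" shows "z + int a * int i \<in> int ` L"
proof -
  obtain m where m: "m \<in> L" "z = int m" using assms by blast
  then obtain s j where "s \<in> \<Gamma>" "m = k * s + a * j" unfolding mem_L by blast
  then have sj: "s \<in> \<Gamma>" "z = int (k * s + a * j)" using m(2) by simp_all
  then have "z + int a * int i = int (k * s + a * (j + i))" by (simp add: algebra_simps)
  moreover have "k * s + a * (j + i) \<in> L" using sj mem_L by blast
  ultimately show ?thesis by (metis imageI)
qed

text \<open>In a representation \<open>k s + a i\<close> with \<open>s \<in> \<Gamma>\<close>, reducing \<open>i\<close> modulo \<open>k\<close> adds a multiple
  of \<open>a\<close> to \<open>s\<close>, which stays in \<open>\<Gamma>\<close> because \<open>a \<in> \<Gamma>\<close>. Uniqueness of digits does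
  the rest.\<close>

lemma digits_mem_iff:
  assumes j: "0 \<le> j" "j < int k"
  shows "digits (y, j) \<in> int ` L \<longleftrightarrow> y \<in> int ` \<Gamma>"
proof
  assume "y \<in> int ` \<Gamma>"
  then obtain s where "s \<in> \<Gamma>" "y = int s" by blast
  moreover have "digits (int s, j) = int (k * s + a * nat j)"
    using j by (simp add: digits_def)
  ultimately show "digits (y, j) \<in> int ` L" using mem_L by blast
next
  assume "digits (y, j) \<in> int ` L"
  then obtain m where m: "m \<in> L" "digits (y, j) = int m" by blast
  then obtain s i where s: "s \<in> \<Gamma>" and "m = k * s + a * i" unfolding mem_L by blast
  then have "digits (y, j) = int (k * s + a * i)" using m(2) by simp
  also have "\<dots> = int k * int s + int a * (int k * (int i div int k) + int i mod int k)" by simp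
  also have "\<dots> = digits (int s + int a * (int i div int k), int i mod int k)"
    unfolding digits_def by (simp only: prod.case algebra_simps)
  finally have "(y, j) = (int s + int a * (int i div int k), int i mod int k)"
    using j k_pos by (intro inj_onD[OF bij_betw_imp_inj_on[OF digits_bij]]) auto
  then have y: "y = int (s + i div k * a)" by (simp add: zdiv_int mult.commute)
  have "m * a \<in> \<Gamma>" for m
    using sgp a_mem by (induction m) (auto simp: numerical_semigroup_def)
  then have "s + i div k * a \<in> \<Gamma>"
    using s sgp by (simp add: numerical_semigroup_def)
  then show "y \<in> int ` \<Gamma>" unfolding y by (rule imageI)
qed

lemma digits_cases:
  obtains y j where "z = digits (y, j)" "0 \<le> j" "j < int k"
proof -
  have "z \<in> digits ` (UNIV \<times> {0..<int k})" using digits_bij by (simp add: bij_betw_def)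
  then show ?thesis using that by auto
qed

abbreviation top_gap :: int where
  "top_gap \<equiv> digits (int (frobenius_number \<Gamma>), int k - 1)"

lemma finite_compl: "finite (- \<Gamma>)"
  using sgp by (simp add: numerical_semigroup_def)

lemma gap_le_top_gap:
  assumes "z \<notin> int ` L" shows "z \<le> top_gap"
proof -
  obtain y j where z: "z = digits (y, j)" and j: "0 \<le> j" "j < int k" by (rule digits_cases)
  have "y \<notin> int ` \<Gamma>" using assms digits_mem_iff[OF j] unfolding z by simp
  then have "y \<le> int (frobenius_number \<Gamma>)"
    by (rule int_gap_le_frobenius_number[OF finite_compl])
  moreover have "j \<le> int k - 1" using j by simp
  ultimately show ?thesis
    unfolding z digits_def prod.case by (intro add_mono mult_left_mono) simp_all
qed

lemma top_gap_nonneg: "0 \<le> top_gap"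
  using k_pos by (simp add: digits_def)

lemma top_gap_gap: "top_gap \<notin> int ` L"
  using digits_mem_iff[of "int k - 1"] k_pos frobenius_number_gap[OF finite_compl proper] by auto

lemma L_compl_finite: "finite (- L)"
proof (rule finite_subset)
  show "- L \<subseteq> {..nat top_gap}"
    using gap_le_top_gap by (force simp: nat_le_iff le_nat_iff[OF top_gap_nonneg])
qed simp

lemma L_proper: "L \<noteq> UNIV"
  using top_gap_gap top_gap_nonneg by (metis UNIV_I image_eqI int_nat_eq)

lemma L_semigroup: "numerical_semigroup L"
proof -
  have "0 \<in> L" unfolding mem_L using sgp
    by (intro bexI[of _ 0] exI[of _ 0]) (auto simp: numerical_semigroup_def)
  moreover have "x + x' \<in> L" if x: "x \<in> L" "x' \<in> L" for x x'
  proof -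
    obtain s j s' j' where *: "s \<in> \<Gamma>" "x = k * s + a * j" "s' \<in> \<Gamma>" "x' = k * s' + a * j'"
      using x unfolding mem_L by blast
    then have "x + x' = k * (s + s') + a * (j + j')" by (simp add: algebra_simps)
    moreover have "s + s' \<in> \<Gamma>" using * sgp by (simp add: numerical_semigroup_def)
    ultimately show ?thesis unfolding mem_L by blast
  qed
  ultimately show ?thesis using L_compl_finite by (simp add: numerical_semigroup_def)
qed

lemma frobenius_number_L: "int (frobenius_number L) = top_gap"
proof (rule antisym)
  show "int (frobenius_number L) \<le> top_gap"
    using frobenius_number_gap[OF L_compl_finite L_proper] by (intro gap_le_top_gap) auto
  show "top_gap \<le> int (frobenius_number L)"
    using int_gap_le_frobenius_number[OF L_compl_finite top_gap_gap] .
qed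

lemma card_digitwise:
  assumes "\<And>y j. 0 \<le> j \<Longrightarrow> j < int k \<Longrightarrow> digits (y, j) \<in> A \<longleftrightarrow> y \<in> B"
  shows "card A = card B * k"
proof -
  have "A = digits ` (B \<times> {0..<int k})"
  proof (intro equalityI subsetI)
    fix z assume "z \<in> A"
    moreover obtain y j where j: "z = digits (y, j)" "0 \<le> j" "j < int k" by (rule digits_cases)
    ultimately have "y \<in> B" using assms by simp
    then show "z \<in> digits ` (B \<times> {0..<int k})" using j by simp
  next
    fix z assume "z \<in> digits ` (B \<times> {0..<int k})"
    then obtain y j where "z = digits (y, j)" "y \<in> B" "0 \<le> j" "j < int k" by auto
    then show "z \<in> A" using assms by simp
  qed
  moreover have "inj_on digits (B \<times> {0..<int k})"
    by (rule inj_on_subset[OF bij_betw_imp_inj_on[OF digits_bij]]) auto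
  ultimately show ?thesis by (simp add: card_image card_cartesian_product)
qed

lemma card_double_gaps: "card (double_gaps L) = card (double_gaps \<Gamma>) * k"
proof (rule card_digitwise)
  fix y j assume j: "0 \<le> j" "j < int k"
  have "int (frobenius_number L) - digits (y, j)
      = digits (int (frobenius_number \<Gamma>) - y, int k - 1 - j)"
    by (simp add: frobenius_number_L) (simp add: digits_def algebra_simps)
  then show "digits (y, j) \<in> double_gaps L \<longleftrightarrow> y \<in> double_gaps \<Gamma>"
    using j by (simp add: double_gaps_def digits_mem_iff)
qed

text \<open>The two implications use the last digit of the gap \<open>g\<close> differently. To verify that
  \<open>k y + a j\<close> is a trace exponent, \<open>g\<close> is taken with the largest last digit \<open>k - 1\<close>: then
  every \<open>g'\<close> has a last digit at most that large, and the difference contributes a non-negative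
  multiple of \<open>a\<close>, which preserves membership. Conversely, the witness \<open>g\<close> has some last digit
  \<open>i\<close>, and testing only the gaps \<open>g'\<close> with the same last digit makes \<open>i\<close> cancel.\<close>

lemma digits_trace_exps_iff:
  assumes j: "0 \<le> j" "j < int k"
  shows "digits (y, j) \<in> trace_exps L \<longleftrightarrow> y \<in> trace_exps \<Gamma>"
proof
  assume "y \<in> trace_exps \<Gamma>"
  then obtain x where x: "x \<notin> int ` \<Gamma>" "\<And>x'. x' \<notin> int ` \<Gamma> \<Longrightarrow> y + x - x' \<in> int ` \<Gamma>"
    unfolding trace_exps_def by blast
  have "digits (y, j) + digits (x, int k - 1) - g' \<in> int ` L" if g': "g' \<notin> int ` L" for g'
  proof -
    obtain x' j' where g'_eq: "g' = digits (x', j')" and j': "0 \<le> j'" "j' < int k"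
      by (rule digits_cases)
    have "x' \<notin> int ` \<Gamma>" using g' digits_mem_iff[OF j'] unfolding g'_eq by simp
    then have "digits (y + x - x', j) \<in> int ` L"
      using x(2) digits_mem_iff[OF j] by simp
    then have "digits (y + x - x', j) + int a * int (nat (int k - 1 - j')) \<in> int ` L"
      by (rule add_multiple_mem)
    then show ?thesis using j' by (simp add: g'_eq digits_def algebra_simps)
  qed
  moreover have "digits (x, int k - 1) \<notin> int ` L"
    using x(1) digits_mem_iff[of "int k - 1" x] k_pos by simp
  ultimately show "digits (y, j) \<in> trace_exps L" unfolding trace_exps_def by blast
next
  assume "digits (y, j) \<in> trace_exps L"
  then obtain g where g: "g \<notin> int ` L"
    "\<And>g'. g' \<notin> int ` L \<Longrightarrow> digits (y, j) + g - g' \<in> int ` L"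
    unfolding trace_exps_def by blast
  obtain x i where g_eq: "g = digits (x, i)" and i: "0 \<le> i" "i < int k"
    by (rule digits_cases)
  have "y + x - x' \<in> int ` \<Gamma>" if x': "x' \<notin> int ` \<Gamma>" for x'
  proof -
    have "digits (x', i) \<notin> int ` L" using digits_mem_iff[OF i] x' by simp
    then have "digits (y, j) + digits (x, i) - digits (x', i) \<in> int ` L"
      using g(2) by (simp add: g_eq)
    also have "digits (y, j) + digits (x, i) - digits (x', i) = digits (y + x - x', j)"
      by (simp add: digits_def algebra_simps)
    finally show ?thesis using digits_mem_iff[OF j] by simp
  qed
  moreover have "x \<notin> int ` \<Gamma>" using g(1) digits_mem_iff[OF i] by (simp add: g_eq)
  ultimately show "y \<in> trace_exps \<Gamma>" unfolding trace_exps_def by blast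
qed

lemma residue_lifted: "residue TYPE('a::field) L = residue TYPE('a) \<Gamma> * k"
  unfolding residue_eq_card[OF finite_compl proper] residue_eq_card[OF L_compl_finite L_proper]
  by (rule card_digitwise) (simp add: digits_mem_iff digits_trace_exps_iff)

lemma genus_minus_sporadic_number_lifted:
  "int (genus L) - int (sporadic_number L) = (int (genus \<Gamma>) - int (sporadic_number \<Gamma>)) * int k"
  using card_double_gaps
  by (simp add: genus_minus_sporadic_number[OF sgp proper]
      genus_minus_sporadic_number[OF L_semigroup L_proper])

end

text \<open>The set of all natural numbers has no Frobenius number, so it has to be excluded. It needs the
  generator \<open>1\<close>, which alone generates it, so it has no minimal system of two or more
  generators.\<close>

lemma one_in_submonoid_generated: "1 \<in> submonoid_generated A \<Longrightarrow> 1 \<in> A"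
  by (induction "1::nat" rule: submonoid_generated.induct) (auto simp: add_is_1)

lemma submonoid_generated_one: "submonoid_generated {1} = UNIV"
proof -
  have "m \<in> submonoid_generated {1}" for m
  proof (induction m)
    case (Suc m)
    then show ?case using submonoid_generated.add[OF Suc submonoid_generated.gen[of 1]] by simp
  qed (rule submonoid_generated.zero)
  then show ?thesis by blast
qed

lemma minimally_generates_UNIV:
  assumes "minimally_generates A UNIV" shows "A = {1}"
proof -
  have "1 \<in> A"
    using assms one_in_submonoid_generated[of A] by (simp add: minimally_generates_def)
  then show ?thesis
    using assms submonoid_generated_one unfolding minimally_generates_def by blast
qed

theorem mainTheorem5:
  fixes \<Gamma> :: "nat set" and n :: "nat \<Rightarrow> nat" and r k :: nat
  assumes "numerical_semigroup \<Gamma>"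
    and "2 \<le> r"
    and "strict_mono_on {1..r} n"
    and "minimally_generates (n ` {1..r}) \<Gamma>"
    and "0 < k"
    and "coprime k (n 1)"
    and "int (residue TYPE('a::field) \<Gamma>) \<le> int (genus \<Gamma>) - int (sporadic_number \<Gamma>)"
  shows "int (residue TYPE('a) (lifting k r n))
           \<le> int (genus (lifting k r n)) - int (sporadic_number (lifting k r n))"
proof -
  have "{1..r} = insert 1 {2..r}" using assms(2) by auto
  then have gens: "n ` {1..r} = insert (n 1) (n ` {2..r})" by (metis image_insert)
  have gen: "submonoid_generated (n ` {1..r}) = \<Gamma>"
    using assms(4) by (simp add: minimally_generates_def)
  have "n 1 < n 2" using assms(2,3) by (auto simp: strict_mono_on_def)
  moreover have "n 1 \<in> n ` {1..r}" "n 2 \<in> n ` {1..r}" using assms(2) by auto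
  ultimately have "n ` {1..r} \<noteq> {1}" by (metis less_irrefl singletonD)
  then have proper: "\<Gamma> \<noteq> UNIV" using assms(4) minimally_generates_UNIV by blast
  interpret lifted \<Gamma> "lifting k r n" k "n 1"
  proof
    show "n 1 \<in> \<Gamma>" using gen gens submonoid_generated.gen by blast
    show "z \<in> lifting k r n \<longleftrightarrow> (\<exists>s\<in>\<Gamma>. \<exists>j. z = k * s + n 1 * j)" for z
      using mem_lifted_semigroup[of z "n 1" k "n ` {2..r}"] gen gens
      by (simp add: lifting_def image_image)
  qed (use assms proper in auto)
  show ?thesis
    unfolding genus_minus_sporadic_number_lifted residue_lifted of_nat_mult
    using assms(7) by (rule mult_right_mono) simp
qed

end
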